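(* Let $A, B, X$ be $n\times n$ complex matrices such that $A$ and $B$ are positive semidefinite, let $0<\nu\leq\frac12$, $r=\min\{\nu,1-\nu\}$ and $r_0=\min\{2r,1-2r\}$. Then $$\left\|A^{\nu}XB^{1-\nu}+A^{1-\nu}XB^{\nu}\right\|_{2}^{2}\leq\left\|AX+XB\right\|_{2}^{2}-2r\left\|AX-XB\right\|_{2}^{2}-r_{0}\left(\left\|A^{\frac12}XB^{\frac12}-AX\right\|_{2}^{2}+\left\|A^{\frac12}XB^{\frac12}-XB\right\|_{2}^{2}\right).$$
   Context: $\|\cdot\|_2$ is the Hilbert-Schmidt norm: $\|T\|_2=\left(\sum_{i,j=1}^n|t_{ij}|^2\right)^{1/2}$ for $T=[t_{ij}]$. Real powers of positive semidefinite matrices are defined by the spectral functional calculus. *)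

theory Defs
  imports Complex_Main "Jordan_Normal_Form.Schur_Decomposition"
begin

definition unitary_mat :: "nat \<Rightarrow> complex mat \<Rightarrow> bool" where
  "unitary_mat n U \<longleftrightarrow>
     U \<in> carrier_mat n n \<and> mat_adjoint U * U = 1\<^sub>m n \<and> U * mat_adjoint U = 1\<^sub>m n"

text \<open>The order on the complex numbers is that of \<^theory>\<open>HOL-Library.Complex_Order\<close>:
  \<^prop>\<open>0 \<le> z\<close> says that \<^term>\<open>z\<close> is real and nonnegative.\<close>

definition psd_mat :: "nat \<Rightarrow> complex mat \<Rightarrow> bool" where
  "psd_mat n A \<longleftrightarrow>
     A \<in> carrier_mat n n \<and> mat_adjoint A = A \<and>
     (\<forall>v \<in> carrier_vec n. 0 \<le> (A *\<^sub>v v) \<bullet>c v)"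

definition spectral_decomp :: "complex mat \<Rightarrow> complex mat \<Rightarrow> (nat \<Rightarrow> real) \<Rightarrow> bool" where
  "spectral_decomp A U d \<longleftrightarrow>
     unitary_mat (dim_row A) U \<and>
     A = U * mat_diag (dim_row A) (\<lambda>i. complex_of_real (d i)) * mat_adjoint U"

text \<open>Functional calculus for a Hermitian matrix. By \<open>hermitian_fun_eq\<close> below, the result
  does not depend on the chosen diagonalization.\<close>

definition hermitian_fun :: "(real \<Rightarrow> real) \<Rightarrow> complex mat \<Rightarrow> complex mat" where
  "hermitian_fun f A =
     (THE P. \<exists>U d. spectral_decomp A U d \<and>
        P = U * mat_diag (dim_row A) (\<lambda>i. complex_of_real (f (d i))) * mat_adjoint U)"

text \<open>Intended for positive semidefinite \<^term>\<open>A\<close> and \<^term>\<open>s > 0\<close>; note that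
  \<^term>\<open>0 powr s\<close> is \<^term>\<open>0\<close>, also for \<^term>\<open>s = 0\<close>.\<close>

definition mat_powr :: "complex mat \<Rightarrow> real \<Rightarrow> complex mat" where
  "mat_powr A s = hermitian_fun (\<lambda>x. x powr s) A"

definition hs_norm :: "complex mat \<Rightarrow> real" where
  "hs_norm T = sqrt (\<Sum>i<dim_row T. \<Sum>j<dim_col T. (cmod (T $$ (i, j)))\<^sup>2)"

lemma mat_adjoint_carrier: "U \<in> carrier_mat n m \<Longrightarrow> mat_adjoint U \<in> carrier_mat m n"
  unfolding mat_adjoint_def by auto

lemma spectral_fun_unique:
  fixes f :: "real \<Rightarrow> real"
  assumes U: "unitary_mat n U" and V: "unitary_mat n V"
    and eq: "U * mat_diag n (\<lambda>i. complex_of_real (d i)) * mat_adjoint U =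
             V * mat_diag n (\<lambda>i. complex_of_real (e i)) * mat_adjoint V"
  shows "U * mat_diag n (\<lambda>i. complex_of_real (f (d i))) * mat_adjoint U =
         V * mat_diag n (\<lambda>i. complex_of_real (f (e i))) * mat_adjoint V"
proof -
  define U' V' where "U' = mat_adjoint U" and "V' = mat_adjoint V"
  have c: "U \<in> carrier_mat n n" "V \<in> carrier_mat n n" "U' \<in> carrier_mat n n" "V' \<in> carrier_mat n n"
    using U V by (auto simp: unitary_mat_def U'_def V'_def intro: mat_adjoint_carrier)
  have inv: "U' * U = 1\<^sub>m n" "U * U' = 1\<^sub>m n" "V' * V = 1\<^sub>m n" "V * V' = 1\<^sub>m n"
    using U V by (auto simp: unitary_mat_def U'_def V'_def)
  define W where "W = V' * U"
  have Wc: "W \<in> carrier_mat n n" using c by (simp add: W_def)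
  have move: "W * D = E * W \<longleftrightarrow> U * D * U' = V * E * V'"
    if D: "D \<in> carrier_mat n n" and E: "E \<in> carrier_mat n n" for D E
  proof
    assume h: "W * D = E * W"
    have "U * D * U' = (V * V') * (U * D * U')" using c D inv by simp
    also have "\<dots> = V * (W * D) * U'"
      unfolding W_def using c D by (simp add: assoc_mult_mat[of _ n n _ n _ n])
    also have "\<dots> = V * E * V' * (U * U')"
      unfolding h unfolding W_def using c E by (simp add: assoc_mult_mat[of _ n n _ n _ n])
    finally show "U * D * U' = V * E * V'" using inv c E by simp
  next
    assume h: "U * D * U' = V * E * V'"
    have "W * D = W * D * (U' * U)" using c D inv Wc by simp
    also have "\<dots> = V' * (U * D * U') * U"
      unfolding W_def using c D by (simp add: assoc_mult_mat[of _ n n _ n _ n])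
    also have "\<dots> = (V' * V) * E * W"
      unfolding h unfolding W_def using c E by (simp add: assoc_mult_mat[of _ n n _ n _ n])
    finally show "W * D = E * W" using inv c E by simp
  qed
  have entries: "W * mat_diag n a = mat_diag n b * W \<longleftrightarrow>
      (\<forall>i<n. \<forall>j<n. W $$ (i, j) * a j = b i * W $$ (i, j))" for a b :: "nat \<Rightarrow> complex"
    unfolding mat_diag_mult_left[OF Wc] mat_diag_mult_right[OF Wc] mat_eq_iff by auto
  have "W * mat_diag n (\<lambda>i. complex_of_real (d i)) = mat_diag n (\<lambda>i. complex_of_real (e i)) * W"
    by (rule move[THEN iffD2]) (simp_all only: mat_diag_dim eq U'_def V'_def)
  then have "W * mat_diag n (\<lambda>i. complex_of_real (f (d i))) =
      mat_diag n (\<lambda>i. complex_of_real (f (e i))) * W"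
    unfolding entries by (metis mult.commute mult_cancel_left of_real_eq_iff)
  from move[THEN iffD1, OF _ _ this] show ?thesis
    unfolding U'_def V'_def by (simp only: mat_diag_dim simp_thms)
qed

lemma hermitian_fun_eq:
  assumes "spectral_decomp A U d"
  shows "hermitian_fun f A =
    U * mat_diag (dim_row A) (\<lambda>i. complex_of_real (f (d i))) * mat_adjoint U"
  unfolding hermitian_fun_def
proof (rule the_equality)
  fix P
  assume "\<exists>U d. spectral_decomp A U d \<and>
    P = U * mat_diag (dim_row A) (\<lambda>i. complex_of_real (f (d i))) * mat_adjoint U"
  then obtain V e where V: "spectral_decomp A V e"
    and P: "P = V * mat_diag (dim_row A) (\<lambda>i. complex_of_real (f (e i))) * mat_adjoint V"
    by blast
  show "P = U * mat_diag (dim_row A) (\<lambda>i. complex_of_real (f (d i))) * mat_adjoint U"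
    using V assms unfolding P spectral_decomp_def by (metis spectral_fun_unique)
qed (use assms in blast)

end

theory Submission
  imports Defs "HOL-Analysis.Convex" "Jordan_Normal_Form.Spectral_Radius"
begin

text \<open>Diagonalize \<open>A = U diag(a) U*\<close> and \<open>B = V diag(b) V*\<close> with \<open>U\<close>, \<open>V\<close>
  unitary and nonnegative \<open>a\<close>, \<open>b\<close>, and put \<open>Y = U* X V\<close>. Every matrix under a norm in the
  theorem is a sum or difference of matrices \<open>f(A) X g(B)\<close>, hence of the form \<open>U Z V*\<close> where
  \<open>Z\<close> arises from \<open>Y\<close> by multiplying the \<open>(i, j)\<close> entry with a real number that depends
  only on \<open>a i\<close> and \<open>b j\<close> (\<open>diag_sandwich_eq_multiplier\<close>). The Hilbert-Schmidt norm is
  unitarily invariant, so each squared norm is a sum of these squared factors weighted by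
  \<open>|Y i j|\<^sup>2\<close> (\<open>hs_norm_multiplier\<close>). The theorem therefore follows, term by term, from its
  scalar case (\<open>heinz_refined_scalar\<close>).

  For positive numbers, the scalar case is a convexity statement; if one of them is zero, the
  left-hand side vanishes. With \<open>s = 2 \<nu>\<close>, expanding the square on the left
  gives \<open>F s + 2 a b\<close>, where \<open>F s = a powr s * b powr (2 - s) + a powr (2 - s) * b powr s\<close> is
  a convex function of \<open>s\<close>. The right-hand side minus \<open>2 a b\<close> is, for \<open>0 \<le> s \<le> 1\<close>, exactly
  the piecewise linear interpolation of \<open>F\<close> at \<open>0\<close>, \<open>1/2\<close> and \<open>1\<close>: the term with
  \<open>2 r\<close> comes from the chord over \<open>[0, 1]\<close>, and the term with \<open>r\<^sub>0\<close> is the improvement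
  obtained from the additional node \<open>1/2\<close>.

  The spectral theorem needed here is proved by deflation: an eigenvector is completed to a
  unitary matrix, and conjugation with it splits off a one-dimensional block
  (\<open>hermitian_spectral\<close>).\<close>

section \<open>The scalar inequality\<close>

text \<open>The function \<open>(p, p') \<mapsto> a powr p * b powr p'\<close> is the exponential of a linear function, so its
  value at a convex combination is the weighted geometric mean of the values at the ends, which
  Young's inequality bounds by the arithmetic mean.\<close>

lemma powr_mult_powr_convex:
  fixes a b :: real
  assumes "a > 0" "b > 0" "0 \<le> t" "t \<le> 1"
  shows "a powr ((1 - t) * p + t * q) * b powr ((1 - t) * p' + t * q')
    \<le> (1 - t) * (a powr p * b powr p') + t * (a powr q * b powr q')"
proof -
  have "a powr ((1 - t) * p + t * q) * b powr ((1 - t) * p' + t * q')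
    = (a powr p * b powr p') powr (1 - t) * (a powr q * b powr q') powr t"
    using assms by (simp add: powr_mult powr_powr powr_add mult_ac)
  also have "\<dots> \<le> (1 - t) * (a powr p * b powr p') + t * (a powr q * b powr q')"
    using assms by (intro Youngs_inequality_0) auto
  finally show ?thesis .
qed

text \<open>The right-hand side interpolates the convex left-hand side linearly between \<open>s = 0\<close>,
  \<open>s = 1/2\<close> and \<open>s = 1\<close>. At the middle node both sides are \<open>(a + b) * sqrt (a * b)\<close>.\<close>

lemma heinz_refined_pos:
  fixes a b s :: real
  assumes ab: "a > 0" "b > 0" and s: "0 \<le> s" "s \<le> 1"
  shows "a powr s * b powr (2 - s) + a powr (2 - s) * b powr s
    \<le> a\<^sup>2 + b\<^sup>2 - s * (a - b)\<^sup>2 - min s (1 - s) * ((a + b) * (sqrt a - sqrt b)\<^sup>2)"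
proof -
  define F where "F s = a powr s * b powr (2 - s) + a powr (2 - s) * b powr s" for s
  have F_convex: "F ((1 - t) * p + t * q) \<le> (1 - t) * F p + t * F q"
    if "0 \<le> t" "t \<le> 1" for t p q
    using powr_mult_powr_convex[OF ab that, of p q "2 - p" "2 - q"]
      powr_mult_powr_convex[OF ab that, of "2 - p" "2 - q" p q]
    unfolding F_def by (simp add: algebra_simps)
  have F0: "F 0 = a\<^sup>2 + b\<^sup>2" and F1: "F 1 = 2 * a * b"
    using ab by (simp_all add: F_def)
  have "x powr (3/2) = x * sqrt x" if "x > 0" for x :: real
    using powr_add[of x 1 "1/2"] that by (simp add: powr_half_sqrt)
  then have F_half: "F (1/2) = (a + b) * (sqrt a * sqrt b)"
    using ab by (simp add: F_def powr_half_sqrt algebra_simps)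
  have sq: "(sqrt a - sqrt b)\<^sup>2 = a + b - 2 * (sqrt a * sqrt b)"
    using ab by (simp add: power2_diff)
  show ?thesis
  proof (cases "s \<le> 1/2")
    case True
    have "F s \<le> (1 - 2 * s) * F 0 + 2 * s * F (1/2)"
      using F_convex[of "2 * s" 0 "1/2"] True s by simp
    also have "\<dots> = a\<^sup>2 + b\<^sup>2 - s * (a - b)\<^sup>2 - s * ((a + b) * (sqrt a - sqrt b)\<^sup>2)"
      unfolding F0 F_half sq by (simp add: algebra_simps power2_eq_square)
    finally show ?thesis using True by (simp add: F_def min_def)
  next
    case False
    have "F s \<le> (1 - (2 * s - 1)) * F (1/2) + (2 * s - 1) * F 1"
      using F_convex[of "2 * s - 1" "1/2" 1] False s by (simp add: field_simps)
    also have "\<dots> = a\<^sup>2 + b\<^sup>2 - s * (a - b)\<^sup>2 - (1 - s) * ((a + b) * (sqrt a - sqrt b)\<^sup>2)"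
      unfolding F1 F_half sq by (simp add: algebra_simps power2_eq_square)
    finally show ?thesis using False by (simp add: F_def min_def)
  qed
qed

text \<open>The square on the left expands into the expression of \<open>heinz_refined_pos\<close> at \<open>s = 2 * \<nu>\<close>
  plus the constant cross term \<open>2 * a * b\<close>.\<close>

lemma heinz_refined_scalar:
  fixes a b \<nu> :: real
  assumes ab: "a \<ge> 0" "b \<ge> 0" and \<nu>: "0 < \<nu>" "\<nu> \<le> 1/2"
  shows "(a powr \<nu> * b powr (1 - \<nu>) + a powr (1 - \<nu>) * b powr \<nu>)\<^sup>2
    \<le> (a + b)\<^sup>2 - 2 * \<nu> * (a - b)\<^sup>2 - min (2 * \<nu>) (1 - 2 * \<nu>) *
      ((a powr (1/2) * b powr (1/2) - a)\<^sup>2 + (a powr (1/2) * b powr (1/2) - b)\<^sup>2)"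
proof (cases "a = 0 \<or> b = 0")
  case True
  \<comment> \<open>All mixed powers vanish because \<open>0 powr p = 0\<close>; with \<open>x\<close> the other number,
    this remains to be shown.\<close>
  have "0 \<le> (1 - 2 * \<nu> - min (2 * \<nu>) (1 - 2 * \<nu>)) * x\<^sup>2" for x :: real
    by (intro mult_nonneg_nonneg) auto
  with True show ?thesis using \<nu> by (auto simp: algebra_simps)
next
  case False
  with ab have pos: "a > 0" "b > 0" by auto
  have sqr: "(x powr p)\<^sup>2 = x powr (2 * p)" if "x > 0" for x p :: real
    using that by (simp add: powr_powr mult.commute flip: powr_numeral)
  have ident: "x powr \<nu> * x powr (1 - \<nu>) = x" if "x > 0" for x :: real
    using that by (simp flip: powr_add)
  have "(a powr \<nu> * b powr (1 - \<nu>) + a powr (1 - \<nu>) * b powr \<nu>)\<^sup>2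
      = (a powr \<nu>)\<^sup>2 * (b powr (1 - \<nu>))\<^sup>2 + (a powr (1 - \<nu>))\<^sup>2 * (b powr \<nu>)\<^sup>2
        + 2 * ((a powr \<nu> * a powr (1 - \<nu>)) * (b powr \<nu> * b powr (1 - \<nu>)))"
    by (simp add: power2_eq_square algebra_simps)
  also have "\<dots> = a powr (2 * \<nu>) * b powr (2 - 2 * \<nu>) + a powr (2 - 2 * \<nu>) * b powr (2 * \<nu>)
        + 2 * (a * b)"
    unfolding sqr[OF pos(1)] sqr[OF pos(2)] ident[OF pos(1)] ident[OF pos(2)]
    by (simp add: algebra_simps)
  also have "\<dots> \<le> a\<^sup>2 + b\<^sup>2 - 2 * \<nu> * (a - b)\<^sup>2
      - min (2 * \<nu>) (1 - 2 * \<nu>) * ((a + b) * (sqrt a - sqrt b)\<^sup>2) + 2 * (a * b)"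
    using heinz_refined_pos[OF pos, of "2 * \<nu>"] \<nu> by simp
  also have "a\<^sup>2 + b\<^sup>2 - 2 * \<nu> * (a - b)\<^sup>2
      - min (2 * \<nu>) (1 - 2 * \<nu>) * ((a + b) * (sqrt a - sqrt b)\<^sup>2) + 2 * (a * b)
    = (a + b)\<^sup>2 - 2 * \<nu> * (a - b)\<^sup>2
      - min (2 * \<nu>) (1 - 2 * \<nu>) * ((a + b) * (sqrt a - sqrt b)\<^sup>2)"
    by (simp add: power2_eq_square algebra_simps)
  also have "(a + b) * (sqrt a - sqrt b)\<^sup>2
      = (a powr (1/2) * b powr (1/2) - a)\<^sup>2 + (a powr (1/2) * b powr (1/2) - b)\<^sup>2"
  proof -
    have "(sqrt a * sqrt b - (sqrt a)\<^sup>2)\<^sup>2 + (sqrt a * sqrt b - (sqrt b)\<^sup>2)\<^sup>2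
        = ((sqrt a)\<^sup>2 + (sqrt b)\<^sup>2) * (sqrt a - sqrt b)\<^sup>2"
      by (simp add: power2_eq_square algebra_simps)
    then show ?thesis using pos by (simp add: powr_half_sqrt)
  qed
  finally show ?thesis .
qed

section \<open>Adjoints and unitary matrices\<close>

lemma mat_adjoint_index:
  "i < dim_col A \<Longrightarrow> j < dim_row A \<Longrightarrow> mat_adjoint A $$ (i, j) = conjugate (A $$ (j, i))"
  unfolding mat_adjoint_def by (simp add: mat_of_rows_index)

lemma mat_adjoint_dims [simp]:
  "dim_row (mat_adjoint A) = dim_col A" "dim_col (mat_adjoint A) = dim_row A"
  unfolding mat_adjoint_def by auto

lemma mat_adjoint_adjoint [simp]: "mat_adjoint (mat_adjoint A) = A"
  by (rule eq_matI) (simp_all add: mat_adjoint_index)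

lemma mat_adjoint_mult:
  fixes A B :: "complex mat"
  assumes "dim_col A = dim_row B"
  shows "mat_adjoint (A * B) = mat_adjoint B * mat_adjoint A"
  using assms
  by (intro eq_matI)
    (auto simp: mat_adjoint_index scalar_prod_def sum_conjugate conjugate_dist_mul mult.commute
      intro!: sum.cong)

text \<open>Entries of \<open>P* Q\<close> are inner products of columns. This turns \<open>W* W = 1\<close> into orthonormality
  of the columns of \<open>W\<close>, and entries of \<open>U* (A U)\<close> into values of the form \<open>(A u) \<bullet>c u'\<close>.\<close>

lemma mat_adjoint_mult_index:
  fixes P Q :: "complex mat"
  assumes "dim_row P = dim_row Q" "i < dim_col P" "j < dim_col Q"
  shows "(mat_adjoint P * Q) $$ (i, j) = col Q j \<bullet>c col P i"
  using assms
  by (auto simp: mat_adjoint_index scalar_prod_def mult.commute intro!: sum.cong)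

lemma unitary_matI:
  assumes "U \<in> carrier_mat n n" "mat_adjoint U * U = 1\<^sub>m n"
  shows "unitary_mat n U"
  unfolding unitary_mat_def
  using assms mat_mult_left_right_inverse[of "mat_adjoint U" n U] mat_adjoint_carrier by blast

lemma unitary_matD:
  assumes "unitary_mat n U"
  shows "U \<in> carrier_mat n n" "mat_adjoint U \<in> carrier_mat n n"
    "mat_adjoint U * U = 1\<^sub>m n" "U * mat_adjoint U = 1\<^sub>m n"
  using assms unfolding unitary_mat_def by (auto intro: mat_adjoint_carrier)

lemma unitary_mat_mult:
  assumes U: "unitary_mat n U" and V: "unitary_mat n V"
  shows "unitary_mat n (U * V)"
proof (rule unitary_matI)
  note c = unitary_matD[OF U] unitary_matD[OF V]
  show "U * V \<in> carrier_mat n n" using c by simp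
  have "mat_adjoint (U * V) * (U * V) = mat_adjoint V * ((mat_adjoint U * U) * V)"
    using c(1,2,5,6) by (simp add: mat_adjoint_mult assoc_mult_mat[of _ n n _ n _ n])
  then show "mat_adjoint (U * V) * (U * V) = 1\<^sub>m n"
    using c by simp
qed

lemma unitary_conjugate_inverse:
  assumes U: "unitary_mat n U" and V: "unitary_mat n V" and X: "X \<in> carrier_mat n n"
  shows "U * (mat_adjoint U * X * V) * mat_adjoint V = X"
proof -
  note c = unitary_matD[OF U] unitary_matD[OF V]
  have "U * (mat_adjoint U * X * V) * mat_adjoint V
      = (U * mat_adjoint U) * X * (V * mat_adjoint V)"
    using c(1,2,5,6) X by (simp add: assoc_mult_mat[of _ n n _ n _ n])
  then show ?thesis using c X by simp
qed

section \<open>The spectral theorem\<close>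

text \<open>The vectors of a \<open>corthogonal\<close> family are orthogonal and nonzero, but of arbitrary length. A similarity by such vectors would not preserve Hermitian matrices, so the
  vectors are scaled to unit length.\<close>

lemma normalized_corthogonal_unitary:
  assumes len: "length ws = n" and ws: "set ws \<subseteq> carrier_vec n" and orth: "corthogonal ws"
  shows "unitary_mat n
    (mat_of_cols n (map (\<lambda>w. complex_of_real (1 / sqrt (Re (w \<bullet>c w))) \<cdot>\<^sub>v w) ws))"
    (is "unitary_mat n ?W")
proof (rule unitary_matI)
  define c where "c w = complex_of_real (1 / sqrt (Re (w \<bullet>c w)))" for w
  show carrier: "?W \<in> carrier_mat n n" using len by auto
  have w: "ws ! i \<in> carrier_vec n" if "i < n" for i using that ws len by auto
  have col: "col ?W i = c (ws ! i) \<cdot>\<^sub>v ws ! i" if "i < n" for i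
    unfolding c_def using that len w[OF that] by (subst col_mat_of_cols) auto
  show "mat_adjoint ?W * ?W = 1\<^sub>m n"
  proof (rule eq_matI)
    fix i j assume "i < dim_row (1\<^sub>m n :: complex mat)" "j < dim_col (1\<^sub>m n :: complex mat)"
    then have ij: "i < n" "j < n" by auto
    have "(mat_adjoint ?W * ?W) $$ (i, j) = col ?W j \<bullet>c col ?W i"
      using carrier ij by (intro mat_adjoint_mult_index) auto
    also have "\<dots> = c (ws ! j) * c (ws ! i) * (ws ! j \<bullet>c ws ! i)"
      unfolding col[OF ij(1)] col[OF ij(2)] using w[OF ij(1)] w[OF ij(2)]
      by (simp add: conjugate_smult_vec c_def)
    also have "\<dots> = 1\<^sub>m n $$ (i, j)"
    proof (cases "i = j")
      case False
      then show ?thesis using corthogonalD[OF orth, of j i] ij len by auto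
    next
      case True
      \<comment> \<open>The squared length is a positive real, so the two scaling factors cancel it.\<close>
      define z where "z = ws ! i \<bullet>c ws ! i"
      have "z \<ge> 0" unfolding z_def by (rule conjugate_square_ge_0_vec)
      moreover have "z \<noteq> 0" using corthogonalD[OF orth, of i i] ij len by (auto simp: z_def)
      ultimately obtain x where x: "z = complex_of_real x" "x > 0"
        by (metis complex_eq_iff complex_of_real_def less_eq_complex_def Im_complex_of_real
            Re_complex_of_real order_le_less zero_complex.sel)
      have "c (ws ! i) * c (ws ! i) * z = complex_of_real (1 / sqrt x * (1 / sqrt x) * x)"
        unfolding c_def z_def[symmetric] x by (simp only: Re_complex_of_real of_real_mult)
      also have "1 / sqrt x * (1 / sqrt x) * x = 1"
        using x(2) by (simp add: field_simps)
      finally show ?thesis using True ij by (simp add: z_def)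
    qed
    finally show "(mat_adjoint ?W * ?W) $$ (i, j) = 1\<^sub>m n $$ (i, j)" .
  qed (use carrier in auto)
qed

text \<open>The completion of \<open>v\<close> to a basis starts with \<open>v\<close>, and Gram-Schmidt leaves the first
  vector unchanged.\<close>

lemma unitary_with_first_col:
  assumes v: "v \<in> carrier_vec n" "v \<noteq> 0\<^sub>v n"
  shows "\<exists>W c. unitary_mat n W \<and> col W 0 = c \<cdot>\<^sub>v v"
proof -
  interpret cof_vec_space n "TYPE(complex)" .
  have "n > 0" using v by (cases n) auto
  define b where "b = basis_completion v"
  define ws where "ws = gram_schmidt n b"
  note basis = basis_completion[OF v, folded b_def]
  note gs = gram_schmidt_result[OF basis(2,4,5) ws_def]
  have len: "length ws = n" using gs basis by simp
  have "b = v # tl b" using basis(6,7) \<open>n > 0\<close> by (cases b) auto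
  then have "hd ws = v" unfolding ws_def using gram_schmidt_hd[OF v(1)] by metis
  then have ws0: "ws ! 0 = v" using len \<open>n > 0\<close> by (cases ws) auto
  define f where "f w = complex_of_real (1 / sqrt (Re (w \<bullet>c w))) \<cdot>\<^sub>v w" for w
  have "col (mat_of_cols n (map f ws)) 0 = f v"
    using len \<open>n > 0\<close> v ws0 by (subst col_mat_of_cols) (auto simp: f_def)
  moreover have "unitary_mat n (mat_of_cols n (map f ws))"
    unfolding f_def using normalized_corthogonal_unitary[OF len gs(3,2)] .
  ultimately show ?thesis unfolding f_def by blast
qed

lemma adjoint_conjugation:
  fixes A W :: "complex mat"
  assumes "A \<in> carrier_mat n n" "W \<in> carrier_mat n n" "mat_adjoint A = A"
  shows "mat_adjoint (mat_adjoint W * A * W) = mat_adjoint W * A * W"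
  using assms mat_adjoint_carrier[OF assms(2)]
  by (simp add: mat_adjoint_mult assoc_mult_mat[of _ n n _ n _ n])

lemma block_diag_mult:
  fixes A B C D :: "'a :: comm_ring_1 mat"
  assumes "A \<in> carrier_mat k k" "B \<in> carrier_mat m m" "C \<in> carrier_mat k k" "D \<in> carrier_mat m m"
  shows "four_block_mat A (0\<^sub>m k m) (0\<^sub>m m k) B * four_block_mat C (0\<^sub>m k m) (0\<^sub>m m k) D
    = four_block_mat (A * C) (0\<^sub>m k m) (0\<^sub>m m k) (B * D)"
  using assms by (subst mult_four_block_mat[of _ k k _ m _ m _ _ k _ m]) auto

text \<open>Lifts a diagonalizing matrix of the smaller block to the full size in the deflation step.\<close>

lemma unitary_extend:
  assumes V: "unitary_mat m V"
  shows "unitary_mat (Suc m) (four_block_mat (1\<^sub>m 1) (0\<^sub>m 1 m) (0\<^sub>m m 1) V)"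
    and "mat_adjoint (four_block_mat (1\<^sub>m 1) (0\<^sub>m 1 m) (0\<^sub>m m 1) V)
      = four_block_mat (1\<^sub>m 1) (0\<^sub>m 1 m) (0\<^sub>m m 1) (mat_adjoint V)"
proof -
  note c = unitary_matD[OF V]
  show adj: "mat_adjoint (four_block_mat (1\<^sub>m 1) (0\<^sub>m 1 m) (0\<^sub>m m 1) V)
      = four_block_mat (1\<^sub>m 1) (0\<^sub>m 1 m) (0\<^sub>m m 1) (mat_adjoint V)"
    using c(1) by (intro eq_matI) (auto simp: mat_adjoint_index)
  show "unitary_mat (Suc m) (four_block_mat (1\<^sub>m 1) (0\<^sub>m 1 m) (0\<^sub>m m 1) V)"
  proof (rule unitary_matI)
    show "four_block_mat (1\<^sub>m 1) (0\<^sub>m 1 m) (0\<^sub>m m 1) V \<in> carrier_mat (Suc m) (Suc m)"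
      using four_block_carrier_mat[OF one_carrier_mat c(1), of 1] by simp
    show "mat_adjoint (four_block_mat (1\<^sub>m 1) (0\<^sub>m 1 m) (0\<^sub>m m 1) V)
        * four_block_mat (1\<^sub>m 1) (0\<^sub>m 1 m) (0\<^sub>m m 1) V = 1\<^sub>m (Suc m)"
      unfolding adj using c(1-3) four_block_one_mat[of 1 m]
      by (simp add: block_diag_mult)
  qed
qed

text \<open>Induction on the dimension. Let \<open>W\<close> be unitary with an eigenvector as first column. The first
  column of \<open>W* A W\<close> is then zero below the diagonal; as this matrix is Hermitian, its first row
  vanishes as well and its corner entry, the eigenvalue, is real. The remaining block is Hermitian
  and is diagonalized by the induction hypothesis.\<close>

lemma hermitian_spectral:
  assumes "A \<in> carrier_mat n n" "mat_adjoint A = A"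
  shows "\<exists>U d. unitary_mat n U \<and>
    A = U * mat_diag n (\<lambda>i. complex_of_real (d i)) * mat_adjoint U"
  using assms
proof (induction n arbitrary: A)
  case 0
  have "unitary_mat 0 (1\<^sub>m 0)" by (rule unitary_matI) (auto intro!: eq_matI)
  with 0 show ?case by (intro exI[of _ "1\<^sub>m 0"]) (auto intro!: eq_matI)
next
  case (Suc m)
  define n where "n = Suc m"
  have A: "A \<in> carrier_mat n n" and herm: "mat_adjoint A = A" using Suc.prems by (auto simp: n_def)
  obtain e v where "eigenvector A v e"
    using spectrum_non_empty[OF A] by (auto simp: n_def spectrum_def eigenvalue_def)
  then have v: "v \<in> carrier_vec n" "v \<noteq> 0\<^sub>v n" and Av: "A *\<^sub>v v = e \<cdot>\<^sub>v v"
    using A unfolding eigenvector_def by auto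
  obtain W c where W: "unitary_mat n W" and W0: "col W 0 = c \<cdot>\<^sub>v v"
    using unitary_with_first_col[OF v] by blast
  note cW = unitary_matD[OF W]
  have AW0: "A *\<^sub>v col W 0 = e \<cdot>\<^sub>v col W 0"
    unfolding W0 using A v Av by (simp add: mult_mat_vec smult_smult_assoc mult.commute)
  define A' where "A' = mat_adjoint W * A * W"
  have A': "A' \<in> carrier_mat n n" using A cW by (auto simp: A'_def)
  have A'_herm: "cnj (A' $$ (j, i)) = A' $$ (i, j)" if "i < n" "j < n" for i j
    using mat_adjoint_index[of i A' j] adjoint_conjugation[OF A cW(1) herm] A' that
    by (auto simp: A'_def)
  have A'_col0: "A' $$ (i, 0) = (if i = 0 then e else 0)" if i: "i < n" for i
  proof -
    have "A' = mat_adjoint W * (A * W)"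
      unfolding A'_def using A cW by (simp add: assoc_mult_mat[of _ n n _ n _ n])
    then have "A' $$ (i, 0) = col (A * W) 0 \<bullet>c col W i"
      using mat_adjoint_mult_index[of W "A * W" i 0] A cW(1) i by auto
    also have "col (A * W) 0 = e \<cdot>\<^sub>v col W 0"
      using col_mult2[OF A cW(1), of 0] AW0 by (simp add: n_def)
    also have "(e \<cdot>\<^sub>v col W 0) \<bullet>c col W i = e * (col W 0 \<bullet>c col W i)"
      by simp
    also have "col W 0 \<bullet>c col W i = (mat_adjoint W * W) $$ (i, 0)"
      using mat_adjoint_mult_index[of W W i 0] cW(1) i by auto
    finally show ?thesis unfolding cW(3) using i by auto
  qed
  have "cnj e = e" using A'_herm[of 0 0] A'_col0[of 0] by (auto simp: n_def)
  then have e_real: "e = complex_of_real (Re e)" by (simp add: complex_eq_iff)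
  define A3 where "A3 = mat m m (\<lambda>(i, j). A' $$ (Suc i, Suc j))"
  have "A3 \<in> carrier_mat m m" "mat_adjoint A3 = A3"
    by (auto simp: A3_def mat_adjoint_index A'_herm n_def intro!: eq_matI)
  then obtain V d where V: "unitary_mat m V"
    and A3: "A3 = V * mat_diag m (\<lambda>i. complex_of_real (d i)) * mat_adjoint V"
    using Suc.IH by blast
  note cV = unitary_matD[OF V]
  define P where "P = four_block_mat (1\<^sub>m 1) (0\<^sub>m 1 m) (0\<^sub>m m 1) V"
  have P: "unitary_mat n P" and
    adjP: "mat_adjoint P = four_block_mat (1\<^sub>m 1) (0\<^sub>m 1 m) (0\<^sub>m m 1) (mat_adjoint V)"
    unfolding P_def n_def by (rule unitary_extend[OF V])+
  note cP = unitary_matD[OF P]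
  define d' where "d' = case_nat (Re e) d"
  define D where "D = mat_diag n (\<lambda>i. complex_of_real (d' i))"
  have D_block: "D = four_block_mat (mat 1 1 (\<lambda>_. e)) (0\<^sub>m 1 m) (0\<^sub>m m 1)
      (mat_diag m (\<lambda>i. complex_of_real (d i)))"
    using e_real unfolding D_def d'_def mat_diag_def n_def
    by (intro eq_matI) (auto split: nat.splits)
  have "A' = four_block_mat (mat 1 1 (\<lambda>_. e)) (0\<^sub>m 1 m) (0\<^sub>m m 1) A3"
  proof (rule eq_matI)
    fix i j
    assume "i < dim_row (four_block_mat (mat 1 1 (\<lambda>_. e)) (0\<^sub>m 1 m) (0\<^sub>m m 1) A3)"
      and "j < dim_col (four_block_mat (mat 1 1 (\<lambda>_. e)) (0\<^sub>m 1 m) (0\<^sub>m m 1) A3)"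
    then have ij: "i < n" "j < n" by (auto simp: n_def A3_def)
    show "A' $$ (i, j) = four_block_mat (mat 1 1 (\<lambda>_. e)) (0\<^sub>m 1 m) (0\<^sub>m m 1) A3 $$ (i, j)"
      using A'_col0[OF ij(1)] A'_col0[OF ij(2)] A'_herm[OF ij] ij
      by (cases i; cases j) (auto simp: A3_def n_def)
  qed (use A' in \<open>auto simp: A3_def n_def\<close>)
  also have "\<dots> = P * D * mat_adjoint P"
    unfolding adjP D_block unfolding P_def using cV(1,2)
    by (simp add: block_diag_mult A3)
  finally have A'_eq: "A' = P * D * mat_adjoint P" .
  have D: "D \<in> carrier_mat n n" by (simp add: D_def)
  have "A = W * A' * mat_adjoint W"
    unfolding A'_def by (rule unitary_conjugate_inverse[OF W W A, symmetric])
  also have "\<dots> = (W * P) * D * mat_adjoint (W * P)"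
    unfolding A'_eq using cW(1,2) cP(1,2) D
    by (simp add: mat_adjoint_mult assoc_mult_mat[of _ n n _ n _ n])
  finally show ?case
    using unitary_mat_mult[OF W P] unfolding D_def n_def
    by (intro exI[of _ "W * P"] exI[of _ d'] conjI)
qed

text \<open>The eigenvalue \<open>d i\<close> equals \<open>(A u) \<bullet>c u\<close> for the \<open>i\<close>-th column \<open>u\<close> of \<open>U\<close>.\<close>

lemma psd_spectral:
  assumes "psd_mat n A"
  obtains U d where "unitary_mat n U" "spectral_decomp A U d" "\<And>i. i < n \<Longrightarrow> d i \<ge> 0"
proof -
  have A: "A \<in> carrier_mat n n" and herm: "mat_adjoint A = A"
    and pos: "\<And>v. v \<in> carrier_vec n \<Longrightarrow> 0 \<le> (A *\<^sub>v v) \<bullet>c v"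
    using assms by (auto simp: psd_mat_def)
  obtain U d where U: "unitary_mat n U"
    and A_eq: "A = U * mat_diag n (\<lambda>i. complex_of_real (d i)) * mat_adjoint U"
    using hermitian_spectral[OF A herm] by blast
  note c = unitary_matD[OF U]
  define D where "D = mat_diag n (\<lambda>i. complex_of_real (d i))"
  have D: "D \<in> carrier_mat n n" by (simp add: D_def)
  have "mat_adjoint U * (A * U) = (mat_adjoint U * U) * D * (mat_adjoint U * U)"
    unfolding A_eq D_def[symmetric] using c(1,2) D by (simp add: assoc_mult_mat[of _ n n _ n _ n])
  then have UAU: "mat_adjoint U * (A * U) = D" using c(3) D by simp
  have "d i \<ge> 0" if i: "i < n" for i
  proof -
    have "complex_of_real (d i) = (mat_adjoint U * (A * U)) $$ (i, i)"
      unfolding UAU D_def mat_diag_def using i by simp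
    also have "\<dots> = (A *\<^sub>v col U i) \<bullet>c col U i"
      using mat_adjoint_mult_index[of U "A * U" i i] col_mult2[OF A c(1) i] A c(1) i
      by (simp del: index_mult_mat(1) col_mult)
    finally have "complex_of_real (d i) = (A *\<^sub>v col U i) \<bullet>c col U i" .
    moreover have "col U i \<in> carrier_vec n" using c(1) i by auto
    ultimately have "0 \<le> complex_of_real (d i)" using pos by metis
    then show ?thesis by (simp add: less_eq_complex_def)
  qed
  with U A_eq A show thesis by (intro that[of U d]) (auto simp: spectral_decomp_def)
qed

section \<open>The Hilbert-Schmidt norm and two-sided multipliers\<close>

lemma hs_norm_nonneg: "0 \<le> hs_norm T"
  unfolding hs_norm_def by (simp add: sum_nonneg)

lemma hs_norm_sq:
  "(hs_norm T)\<^sup>2 = (\<Sum>i<dim_row T. \<Sum>j<dim_col T. (cmod (T $$ (i, j)))\<^sup>2)"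
  unfolding hs_norm_def by (simp add: sum_nonneg)

lemma hs_norm_adjoint: "hs_norm (mat_adjoint T) = hs_norm T"
  unfolding hs_norm_def by (simp add: mat_adjoint_index) (subst sum.swap, rule refl)

text \<open>The squared norm is the trace of \<open>T* T\<close>, and \<open>(U T)* (U T) = T* T\<close> for unitary \<open>U\<close>;
  unitary invariance needs no computation with entries in this form.\<close>

lemma hs_norm_sq_trace:
  "complex_of_real ((hs_norm T)\<^sup>2) = (\<Sum>j<dim_col T. (mat_adjoint T * T) $$ (j, j))"
proof -
  have "(mat_adjoint T * T) $$ (j, j) = (\<Sum>i<dim_row T. complex_of_real ((cmod (T $$ (i, j)))\<^sup>2))"
    if "j < dim_col T" for j
    unfolding mat_adjoint_mult_index[OF refl that that] complex_norm_square
    using that by (simp add: scalar_prod_def atLeast0LessThan)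
  then show ?thesis
    unfolding hs_norm_sq by (subst sum.swap) simp
qed

lemma hs_norm_unitary_left:
  assumes U: "unitary_mat n U" and T: "T \<in> carrier_mat n m"
  shows "hs_norm (U * T) = hs_norm T"
proof -
  note c = unitary_matD[OF U]
  have "mat_adjoint (U * T) * (U * T) = mat_adjoint T * ((mat_adjoint U * U) * T)"
    using c(1,2) T mat_adjoint_carrier[OF T]
    by (simp add: mat_adjoint_mult assoc_mult_mat[of _ m n _ n _ m]
        assoc_mult_mat[of _ n n _ n _ m])
  then have "mat_adjoint (U * T) * (U * T) = mat_adjoint T * T"
    using c(3) T by simp
  then have "complex_of_real ((hs_norm (U * T))\<^sup>2) = complex_of_real ((hs_norm T)\<^sup>2)"
    unfolding hs_norm_sq_trace using c(1) T by simp
  then have "(hs_norm (U * T))\<^sup>2 = (hs_norm T)\<^sup>2" by (simp only: of_real_eq_iff)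
  then show ?thesis by (rule power2_eq_imp_eq) (rule hs_norm_nonneg)+
qed

text \<open>Multiplication from the right becomes multiplication from the left after taking adjoints.\<close>

lemma hs_norm_unitary:
  assumes U: "unitary_mat n U" and V: "unitary_mat n V" and T: "T \<in> carrier_mat n n"
  shows "hs_norm (U * T * mat_adjoint V) = hs_norm T"
proof -
  note c = unitary_matD[OF U] unitary_matD[OF V]
  have "hs_norm (U * T * mat_adjoint V) = hs_norm (mat_adjoint (U * T * mat_adjoint V))"
    by (simp only: hs_norm_adjoint)
  also have "mat_adjoint (U * T * mat_adjoint V) = V * mat_adjoint (U * T)"
    using c T by (subst mat_adjoint_mult) auto
  also have "hs_norm \<dots> = hs_norm (mat_adjoint (U * T))"
    by (rule hs_norm_unitary_left[OF V mat_adjoint_carrier[OF mult_carrier_mat[OF c(1) T]]])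
  also have "\<dots> = hs_norm T"
    unfolding hs_norm_adjoint by (rule hs_norm_unitary_left[OF U T])
  finally show ?thesis .
qed

text \<open>A Schur (entrywise) multiplier \<open>c\<close> acting on \<open>Y\<close>, written in the orthonormal bases given by
  the columns of \<open>U\<close> and \<open>V\<close>.\<close>

definition multiplier ::
  "nat \<Rightarrow> complex mat \<Rightarrow> complex mat \<Rightarrow> complex mat \<Rightarrow> (nat \<Rightarrow> nat \<Rightarrow> real) \<Rightarrow> complex mat" where
  "multiplier n U V Y c = U * mat n n (\<lambda>(i, j). complex_of_real (c i j) * Y $$ (i, j)) * mat_adjoint V"

lemma hs_norm_multiplier:
  assumes "unitary_mat n U" "unitary_mat n V"
  shows "(hs_norm (multiplier n U V Y c))\<^sup>2 = (\<Sum>i<n. \<Sum>j<n. (c i j)\<^sup>2 * (cmod (Y $$ (i, j)))\<^sup>2)"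
  unfolding multiplier_def using assms
  by (simp add: hs_norm_unitary hs_norm_sq norm_mult power_mult_distrib)

lemma multiplier_add:
  assumes "U \<in> carrier_mat n n" "V \<in> carrier_mat n n"
  shows "multiplier n U V Y c + multiplier n U V Y c' = multiplier n U V Y (\<lambda>i j. c i j + c' i j)"
proof -
  let ?T = "\<lambda>c. mat n n (\<lambda>(i, j). complex_of_real (c i j) * Y $$ (i, j))"
  have "?T (\<lambda>i j. c i j + c' i j) = ?T c + ?T c'"
    by (rule eq_matI) (auto simp: algebra_simps)
  then show ?thesis
    unfolding multiplier_def using assms mat_adjoint_carrier[OF assms(2)]
    by (simp add: mult_add_distrib_mat[of _ n n _ n] add_mult_distrib_mat[of _ n n _ _ n])
qed

lemma multiplier_diff:
  assumes "U \<in> carrier_mat n n" "V \<in> carrier_mat n n"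
  shows "multiplier n U V Y c - multiplier n U V Y c' = multiplier n U V Y (\<lambda>i j. c i j - c' i j)"
proof -
  let ?T = "\<lambda>c. mat n n (\<lambda>(i, j). complex_of_real (c i j) * Y $$ (i, j))"
  have "?T (\<lambda>i j. c i j - c' i j) = ?T c - ?T c'"
    by (rule eq_matI) (auto simp: algebra_simps)
  then show ?thesis
    unfolding multiplier_def using assms mat_adjoint_carrier[OF assms(2)]
    by (simp add: mult_minus_distrib_mat[of _ n n _ n] minus_mult_distrib_mat[of _ n n _ _ n])
qed

text \<open>The matrix \<open>f(A) X g(B)\<close> is an entrywise multiple of \<open>U* X V\<close> in the eigenbases, since
  diagonal matrices scale rows and columns.\<close>

lemma diag_sandwich_eq_multiplier:
  assumes U: "unitary_mat n U" and V: "unitary_mat n V" and X: "X \<in> carrier_mat n n"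
  shows "(U * mat_diag n (\<lambda>i. complex_of_real (f i)) * mat_adjoint U) * X
      * (V * mat_diag n (\<lambda>j. complex_of_real (g j)) * mat_adjoint V)
    = multiplier n U V (mat_adjoint U * X * V) (\<lambda>i j. f i * g j)"
proof -
  note c = unitary_matD[OF U] unitary_matD[OF V]
  define D where "D = mat_diag n (\<lambda>i. complex_of_real (f i))"
  define E where "E = mat_diag n (\<lambda>i. complex_of_real (g i))"
  define Y where "Y = mat_adjoint U * X * V"
  have DE: "D \<in> carrier_mat n n" "E \<in> carrier_mat n n" by (simp_all add: D_def E_def)
  have Y: "Y \<in> carrier_mat n n" using c X by (auto simp: Y_def)
  have "(U * D * mat_adjoint U) * X * (V * E * mat_adjoint V) = U * (D * Y * E) * mat_adjoint V"
    unfolding Y_def using c(1,2,5,6) X DE by (simp add: assoc_mult_mat[of _ n n _ n _ n])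
  also have "D * Y * E = mat n n (\<lambda>(i, j). complex_of_real (f i * g j) * Y $$ (i, j))"
    unfolding D_def E_def mat_diag_mult_left[OF Y]
    by (subst mat_diag_mult_right[of _ n]) (auto intro!: eq_matI)
  finally show ?thesis unfolding multiplier_def D_def E_def Y_def .
qed

section \<open>The matrix inequality\<close>

theorem theorem3p13:
  fixes n :: nat and A B X :: "complex mat" and \<nu> r r\<^sub>0 :: real
  assumes "psd_mat n A" and "psd_mat n B" and "X \<in> carrier_mat n n"
    and "0 < \<nu>" and "\<nu> \<le> 1 / 2"
    and "r = min \<nu> (1 - \<nu>)" and "r\<^sub>0 = min (2 * r) (1 - 2 * r)"
  shows "(hs_norm (mat_powr A \<nu> * X * mat_powr B (1 - \<nu>) +
                   mat_powr A (1 - \<nu>) * X * mat_powr B \<nu>))\<^sup>2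
    \<le> (hs_norm (A * X + X * B))\<^sup>2 - 2 * r * (hs_norm (A * X - X * B))\<^sup>2
      - r\<^sub>0 * ((hs_norm (mat_powr A (1 / 2) * X * mat_powr B (1 / 2) - A * X))\<^sup>2
             + (hs_norm (mat_powr A (1 / 2) * X * mat_powr B (1 / 2) - X * B))\<^sup>2)"
proof -
  have A: "A \<in> carrier_mat n n" and B: "B \<in> carrier_mat n n" and X: "X \<in> carrier_mat n n"
    using assms(1-3) by (auto simp: psd_mat_def)
  have r: "r = \<nu>" and r0: "r\<^sub>0 = min (2 * \<nu>) (1 - 2 * \<nu>)" using assms(4-7) by auto
  obtain U a where U: "unitary_mat n U" and Ua: "spectral_decomp A U a"
    and a: "\<And>i. i < n \<Longrightarrow> a i \<ge> 0"
    using psd_spectral[OF assms(1)] by blast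
  obtain V b where V: "unitary_mat n V" and Vb: "spectral_decomp B V b"
    and b: "\<And>i. i < n \<Longrightarrow> b i \<ge> 0"
    using psd_spectral[OF assms(2)] by blast
  note c = unitary_matD[OF U] unitary_matD[OF V]
  define Y where "Y = mat_adjoint U * X * V"
  let ?M = "multiplier n U V Y"
  note sandwich = diag_sandwich_eq_multiplier[OF U V X, folded Y_def]
  have powr: "mat_powr A s * X * mat_powr B t = ?M (\<lambda>i j. a i powr s * b j powr t)" for s t
    using sandwich[of "\<lambda>i. a i powr s" "\<lambda>j. b j powr t"] A B
    unfolding mat_powr_def hermitian_fun_eq[OF Ua] hermitian_fun_eq[OF Vb] by simp
  have A_eq: "A = U * mat_diag n (\<lambda>i. complex_of_real (a i)) * mat_adjoint U"
    and B_eq: "B = V * mat_diag n (\<lambda>i. complex_of_real (b i)) * mat_adjoint V"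
    using Ua Vb A B by (auto simp: spectral_decomp_def)
  \<comment> \<open>Here \<open>f(A) X g(B)\<close> has \<open>f = id\<close> and \<open>g = 1\<close>, or conversely.\<close>
  have AX: "A * X = ?M (\<lambda>i j. a i)"
    using sandwich[of a "\<lambda>_. 1"] c A X by (simp add: A_eq[symmetric])
  have XB: "X * B = ?M (\<lambda>i j. b j)"
    using sandwich[of "\<lambda>_. 1" b] c B X by (simp add: B_eq[symmetric])
  define y where "y i j = (cmod (Y $$ (i, j)))\<^sup>2" for i j
  note norm = hs_norm_multiplier[OF U V, of Y, folded y_def]
  note add = multiplier_add[OF c(1,5)] and diff = multiplier_diff[OF c(1,5)]
  have "(\<Sum>i<n. \<Sum>j<n.
        (a i powr \<nu> * b j powr (1 - \<nu>) + a i powr (1 - \<nu>) * b j powr \<nu>)\<^sup>2 * y i j)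
    \<le> (\<Sum>i<n. \<Sum>j<n. ((a i + b j)\<^sup>2 - 2 * \<nu> * (a i - b j)\<^sup>2 - r\<^sub>0 *
        ((a i powr (1/2) * b j powr (1/2) - a i)\<^sup>2
          + (a i powr (1/2) * b j powr (1/2) - b j)\<^sup>2)) * y i j)"
    unfolding r0 y_def
    by (rule sum_mono, rule sum_mono, rule mult_right_mono, rule heinz_refined_scalar)
      (use a b assms(4,5) in auto)
  then show ?thesis
    unfolding powr AX XB add diff norm r
    by (simp add: algebra_simps sum.distrib sum_subtractf sum_distrib_left)
qed

end
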